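(* Let $l>1$ be a real number. For every $N$ let $A=A(N)$ be a random Hermitian matrix of size $N$ with eigenvalues $\lambda_1(A)\le\dots\le\lambda_N(A)$. Assume that for every $r\in\mathbb{N}$ one has $$\lim_{N\to\infty}\frac{1}{N^l}\log\mathbb{E}\left[HC(x_1,\dots,x_r,0^{N-r};\lambda_1(A),\dots,\lambda_N(A))\right]=\sum_{i=1}^r\Psi(x_i),$$ where $\Psi$ is a smooth function in a complex neighborhood of $0$ and the convergence is uniform in a complex neighborhood of $0^r$. Then the random measure $N^{-1}\sum_{i=1}^N\delta\left(N^{-l}\lambda_i(A)\right)$ converges, as $N\to\infty$, in probability, in the sense of moments, to the Dirac measure $\delta(\Psi'(0))$; that is, for every $k\in\mathbb{N}$ the random variable $N^{-1}\sum_{i=1}^N\left(N^{-l}\lambda_i(A)\right)^k$ converges in probability to $(\Psi'(0))^k$.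
   Context: $\mathbb{N}=\{1,2,\dots\}$; $0^m$ denotes $m$ zeros $(0,\dots,0)$; $\delta(a)$ is the Dirac mass at $a$. For $x_1,\dots,x_N\in\mathbb{C}$ and $\lambda_1,\dots,\lambda_N\in\mathbb{R}$ the Harish-Chandra integral is $$HC(x_1,\dots,x_N;\lambda_1,\dots,\lambda_N)=\int_{U(N)}\exp\left(\operatorname{Tr}(D_\lambda U D_x U^* )\right)\mathbf{m}_N(dU),$$ where $D_\lambda=\operatorname{diag}(\lambda_1,\dots,\lambda_N)$, $D_x=\operatorname{diag}(x_1,\dots,x_N)$ and $\mathbf{m}_N$ is the Haar probability measure on the unitary group $U(N)$. The expectation $\mathbb{E}$ is over the random eigenvalues of $A$. The hypothesis implicitly includes that the expectations are finite and that the logarithm (the branch equal to $0$ at $x=0$) is well defined near the origin. "Smooth in a complex neighborhood" means complex differentiable (holomorphic). *)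

theory Defs
  imports
    "HOL-Probability.Probability"
    "HOL-Complex_Analysis.Complex_Analysis"
    "Jordan_Normal_Form.Schur_Decomposition"
begin

definition mat_trace :: "complex mat \<Rightarrow> complex" where
  "mat_trace A = (\<Sum>i<dim_row A. A $$ (i, i))"

definition hermitian_mats :: "nat \<Rightarrow> complex mat set" where
  "hermitian_mats n = {A \<in> carrier_mat n n. mat_adjoint A = A}"

definition unitary_group :: "nat \<Rightarrow> complex mat set" where
  "unitary_group n =
     {U \<in> carrier_mat n n. U * mat_adjoint U = 1\<^sub>m n \<and> mat_adjoint U * U = 1\<^sub>m n}"

text \<open>The Borel \<open>\<sigma>\<close>-algebra of the space of \<open>n \<times> n\<close> matrices, i.e. the one generated
  by the \<open>n\<^sup>2\<close> entries; only its space and measurable sets matter.\<close>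

definition mat_borel :: "nat \<Rightarrow> complex mat measure" where
  "mat_borel n =
     vimage_algebra (carrier_mat n n) (\<lambda>A. \<lambda>ij\<in>{..<n} \<times> {..<n}. A $$ ij)
       (PiM ({..<n} \<times> {..<n}) (\<lambda>_. borel))"

text \<open>The Haar probability measure on the compact group \<open>U(n)\<close>: by uniqueness of Haar measure,
  exactly one measure satisfies this predicate.\<close>

definition haar_unitary :: "nat \<Rightarrow> complex mat measure \<Rightarrow> bool" where
  "haar_unitary n \<mu> \<longleftrightarrow>
     prob_space \<mu> \<and>
     sets \<mu> = sets (restrict_space (mat_borel n) (unitary_group n)) \<and>
     (\<forall>V\<in>unitary_group n. distr \<mu> \<mu> (\<lambda>U. V * U) = \<mu>)"

text \<open>The Harish-Chandra integral; the arguments are \<open>x 0, \<dots>, x (n - 1)\<close> and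
  \<open>a 0, \<dots>, a (n - 1)\<close>, and \<open>\<mu>\<close> stands for the Haar measure on \<open>U(n)\<close>.\<close>

definition HC :: "complex mat measure \<Rightarrow> nat \<Rightarrow> (nat \<Rightarrow> complex) \<Rightarrow> (nat \<Rightarrow> real) \<Rightarrow> complex" where
  "HC \<mu> n x a =
     (\<integral>U. exp (mat_trace (mat_diag n (\<lambda>i. complex_of_real (a i)) * U * mat_diag n x * mat_adjoint U)) \<partial>\<mu>)"

text \<open>The eigenvalues of a Hermitian matrix in increasing order, counted with multiplicity
  (\<open>Re\<close> is harmless, as all roots of the characteristic polynomial are real);
  the smallest one has index \<open>0\<close>.\<close>

definition eigval :: "complex mat \<Rightarrow> nat \<Rightarrow> real" where
  "eigval A i = sorted_list_of_multiset (image_mset Re (proots (char_poly A))) ! i"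

definition random_hermitian :: "nat \<Rightarrow> 'w measure \<Rightarrow> ('w \<Rightarrow> complex mat) \<Rightarrow> bool" where
  "random_hermitian n P A \<longleftrightarrow>
     prob_space P \<and> A \<in> P \<rightarrow>\<^sub>M mat_borel n \<and> (\<forall>\<omega>\<in>space P. A \<omega> \<in> hermitian_mats n)"

text \<open>The points \<open>(x\<^sub>1, \<dots>, x\<^sub>r)\<close> of a polydisc around \<open>0\<^sup>r\<close> in complex \<open>r\<close>-space, as
  sequences padded by zeros. Used as an argument of \<open>HC \<mu> n\<close> with \<open>n \<ge> r\<close>, such a sequence is
  \<open>(x\<^sub>1, \<dots>, x\<^sub>r, 0\<^sup>n\<^sup>-\<^sup>r)\<close>; the product topology on sequences induces the usual one on the polydisc.\<close>

definition polydisc0 :: "nat \<Rightarrow> real \<Rightarrow> (nat \<Rightarrow> complex) set" where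
  "polydisc0 r \<epsilon> = {x. (\<forall>i<r. cmod (x i) < \<epsilon>) \<and> (\<forall>i\<ge>r. x i = 0)}"

text \<open>\<open>L\<close> is the branch on \<open>D\<close> of the logarithm of \<open>F\<close> that vanishes at the origin.
  On a connected \<open>D\<close> containing the origin there is at most one.\<close>

definition log_branch ::
    "(nat \<Rightarrow> complex) set \<Rightarrow> ((nat \<Rightarrow> complex) \<Rightarrow> complex) \<Rightarrow> ((nat \<Rightarrow> complex) \<Rightarrow> complex) \<Rightarrow> bool" where
  "log_branch D F L \<longleftrightarrow>
     continuous_on D L \<and> (\<forall>x\<in>D. exp (L x) = F x) \<and> L (\<lambda>_. 0) = 0"

text \<open>Convergence in probability to a constant; the \<open>n\<close>-th variable lives on its own
  probability space. Measurability is part of the notion, since \<open>measure\<close> is \<open>0\<close> on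
  non-measurable sets.\<close>

definition converges_in_prob ::
    "(nat \<Rightarrow> 'w measure) \<Rightarrow> (nat \<Rightarrow> 'w \<Rightarrow> complex) \<Rightarrow> complex \<Rightarrow> bool" where
  "converges_in_prob P X c \<longleftrightarrow>
     (\<forall>n\<ge>1. X n \<in> borel_measurable (P n)) \<and>
     (\<forall>\<epsilon>>0. (\<lambda>n. measure (P n) {\<omega> \<in> space (P n). dist (X n \<omega>) c > \<epsilon>}) \<longlonglongrightarrow> 0)"

end

theory Submission
  imports Defs "HOL-Real_Asymp.Real_Asymp"
begin

text \<open>
  The moments converge because the whole spectrum concentrates: with probability tending to one, all
  scaled eigenvalues \<open>N\<^sup>-\<^sup>l \<lambda>\<^sub>i\<close> are close to \<open>c = \<Psi>' 0\<close>.

  For real \<open>t\<close> the Harish-Chandra integral at \<open>(t, 0, \<dots>, 0)\<close> is the Haar average of \<open>exp (t Z)\<close>,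
  where \<open>Z = \<Sum>\<^sub>i \<lambda>\<^sub>i \<bar>U\<^sub>i\<^sub>0\<bar>\<^sup>2\<close> is a random average of the eigenvalues. The hypothesis thus says that
  the moment generating function of \<open>Z\<close>, over both \<open>A\<close> and \<open>U\<close>, is
  \<open>exp (N\<^sup>l (\<Psi> t + o(1)))\<close>. As \<open>\<Psi> t = c t + o(t)\<close>, the exponential Markov inequality shows that
  \<open>N\<^sup>-\<^sup>l Z\<close> deviates from \<open>c\<close> by a fixed amount only with probability \<open>exp (- \<kappa> N\<^sup>l)\<close>.

  On the other hand, given the eigenvalues, let \<open>i\<close> be the index for which \<open>N\<^sup>-\<^sup>l \<lambda>\<^sub>i\<close> deviates most
  from \<open>c\<close>. If \<open>\<bar>U\<^sub>i\<^sub>0\<bar>\<^sup>2 \<ge> 3 / 4\<close>, then \<open>N\<^sup>-\<^sup>l Z\<close> deviates from \<open>c\<close> at least half as much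
  (\<open>weighted_mean_deviation\<close>), and this event has Haar probability at least \<open>exp (- O (N log N))\<close>
  (\<open>haar_prob_large_entry\<close>). Therefore some eigenvalue deviates by a fixed amount with probability at
  most \<open>exp (O (N log N) - \<kappa> N\<^sup>l)\<close>, which tends to zero because \<open>l > 1\<close>. The two halves meet in
  \<open>deviation_probability_bound\<close>, where the average over \<open>U\<close> is bounded below for each fixed
  value of the eigenvalues before the expectation over \<open>A\<close> is taken.

  Two side issues remain. The derivative \<open>c\<close> is real because the logarithm is real on the real
  axis (\<open>log_branch_real_on_reals\<close>), and the moments are measurable because they are traces of
  powers (\<open>sum_eigval_power_eq_trace\<close>).
\<close>

section \<open>Unitary matrices\<close>

lemma mat_adjoint_carrier:
  assumes "A \<in> carrier_mat n m"
  shows "mat_adjoint A \<in> carrier_mat m n"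
  using assms by (auto simp: mat_adjoint_def)

lemma mat_adjoint_index:
  fixes A :: "complex mat"
  assumes "A \<in> carrier_mat n m" "i < m" "j < n"
  shows "mat_adjoint A $$ (i, j) = cnj (A $$ (j, i))"
  using assms by (auto simp: mat_adjoint_def mat_of_rows_index)

lemma mult_mat_index_sum:
  assumes "A \<in> carrier_mat n m" "B \<in> carrier_mat m p" "i < n" "j < p"
  shows "(A * B) $$ (i, j) = (\<Sum>k<m. A $$ (i, k) * B $$ (k, j))"
  using assms by (auto simp: scalar_prod_def atLeast0LessThan intro!: sum.cong)

lemma unitary_group_iff:
  "U \<in> unitary_group n \<longleftrightarrow> U \<in> carrier_mat n n \<and>
     (\<forall>i<n. \<forall>j<n. (\<Sum>k<n. U $$ (i, k) * cnj (U $$ (j, k))) = of_bool (i = j)) \<and>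
     (\<forall>i<n. \<forall>j<n. (\<Sum>k<n. cnj (U $$ (k, i)) * U $$ (k, j)) = of_bool (i = j))"
proof (cases "U \<in> carrier_mat n n")
  case True
  note adj = mat_adjoint_carrier[OF True]
  have 1: "(U * mat_adjoint U) $$ (i, j) = (\<Sum>k<n. U $$ (i, k) * cnj (U $$ (j, k)))"
    if "i < n" "j < n" for i j
    using that by (simp add: mult_mat_index_sum[OF True adj] mat_adjoint_index[OF True])
  have 2: "(mat_adjoint U * U) $$ (i, j) = (\<Sum>k<n. cnj (U $$ (k, i)) * U $$ (k, j))"
    if "i < n" "j < n" for i j
    using that by (simp add: mult_mat_index_sum[OF adj True] mat_adjoint_index[OF True])
  have one: "X = 1\<^sub>m n \<longleftrightarrow> (\<forall>i<n. \<forall>j<n. X $$ (i, j) = of_bool (i = j))"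
    if "X \<in> carrier_mat n n" for X :: "complex mat"
    using that by (auto intro!: eq_matI)
  show ?thesis
    using True 1 2 one[OF mult_carrier_mat[OF True adj]] one[OF mult_carrier_mat[OF adj True]]
    by (simp add: unitary_group_def)
qed (simp add: unitary_group_def)

lemma unitary_column_norm:
  assumes "U \<in> unitary_group n" "j < n"
  shows "(\<Sum>k<n. (cmod (U $$ (k, j)))\<^sup>2) = 1"
proof -
  have "complex_of_real (\<Sum>k<n. (cmod (U $$ (k, j)))\<^sup>2) = (\<Sum>k<n. cnj (U $$ (k, j)) * U $$ (k, j))"
    by (simp add: complex_norm_square mult.commute del: of_real_power)
  also have "\<dots> = 1"
    using assms by (simp add: unitary_group_iff)
  finally show ?thesis
    by (metis of_real_eq_1_iff)
qed

lemma unitary_mult_closed: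
  assumes V: "V \<in> unitary_group n" and U: "U \<in> unitary_group n"
  shows "V * U \<in> unitary_group n"
proof -
  have Vc: "V \<in> carrier_mat n n" and Uc: "U \<in> carrier_mat n n"
    using assms by (auto simp: unitary_group_def)
  note Va = mat_adjoint_carrier[OF Vc] and Ua = mat_adjoint_carrier[OF Uc]
  have adj: "mat_adjoint (V * U) = mat_adjoint U * mat_adjoint V"
    by (rule eq_matI)
      (use Vc Uc Va Ua mult_carrier_mat[OF Vc Uc] mat_adjoint_carrier[OF mult_carrier_mat[OF Vc Uc]]
        in \<open>auto simp del: index_mult_mat(1) simp: mult_mat_index_sum[OF Ua Va]
          mult_mat_index_sum[OF Vc Uc] mat_adjoint_index[OF Vc] mat_adjoint_index[OF Uc]
          mat_adjoint_index[OF mult_carrier_mat[OF Vc Uc]] mult.commute\<close>)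
  have "(V * U) * (mat_adjoint U * mat_adjoint V) = V * (U * mat_adjoint U) * mat_adjoint V"
    using Vc Uc Va Ua by (simp add: assoc_mult_mat[of _ n n _ n _ n])
  also have "\<dots> = 1\<^sub>m n"
    using V U Vc by (simp add: unitary_group_def)
  finally have 1: "(V * U) * (mat_adjoint U * mat_adjoint V) = 1\<^sub>m n" .
  have "(mat_adjoint U * mat_adjoint V) * (V * U) = mat_adjoint U * (mat_adjoint V * V) * U"
    using Vc Uc Va Ua by (simp add: assoc_mult_mat[of _ n n _ n _ n])
  also have "\<dots> = 1\<^sub>m n"
    using V U Ua by (simp add: unitary_group_def)
  finally have 2: "(mat_adjoint U * mat_adjoint V) * (V * U) = 1\<^sub>m n" .
  show ?thesis
    using 1 2 Vc Uc by (simp add: unitary_group_def adj)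
qed

text \<open>A Householder reflection that exchanges \<open>v\<close> and a multiple of the \<open>i\<close>-th basis vector has the
  required row. The phase \<open>\<alpha>\<close> has to be admitted, because such a reflection exists only
  when the inner product of the two exchanged vectors is real; the modulus of the entries of
  \<open>V * U\<close> does not see it.\<close>

lemma unitary_with_row:
  fixes v :: "nat \<Rightarrow> complex"
  assumes v: "(\<Sum>k<n. (cmod (v k))\<^sup>2) = 1" and i: "i < n"
  obtains V \<alpha> where "V \<in> unitary_group n" "cmod \<alpha> = 1"
    "\<And>k. k < n \<Longrightarrow> V $$ (i, k) = \<alpha> * cnj (v k)"
proof -
  \<comment> \<open>Opposite in phase to \<open>v i\<close>, so that \<open>w\<close> below cannot vanish.\<close>
  define \<alpha> where "\<alpha> = (if v i = 0 then 1 else - v i / of_real (cmod (v i)))"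
  have \<alpha>: "cmod \<alpha> = 1"
    by (auto simp: \<alpha>_def norm_divide)
  hence \<alpha>\<alpha>: "\<alpha> * cnj \<alpha> = 1" "cnj \<alpha> * \<alpha> = 1"
    by (simp_all add: complex_norm_square[symmetric] mult.commute)
  have vi: "v i = - \<alpha> * of_real (cmod (v i))"
    by (auto simp: \<alpha>_def)
  define s where "s = 1 + complex_of_real (cmod (v i))"
  have s0: "s \<noteq> 0"
    unfolding s_def by (metis add_nonneg_eq_0_iff norm_ge_zero of_real_1 of_real_add of_real_eq_0_iff zero_le_one zero_neq_one)
  have cs: "cnj s = s" by (simp add: s_def)
  define w where "w k = v k - \<alpha> * of_bool (k = i)" for k
  have wi: "w i = - \<alpha> * s"
    by (subst w_def, subst vi) (simp add: s_def algebra_simps)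
  have vv: "(\<Sum>k<n. v k * cnj (v k)) = 1"
    using arg_cong[OF v, of complex_of_real] by (simp add: complex_norm_square del: of_real_power)
  have vv': "v i * cnj \<alpha> = 1 - s" "cnj (v i) * \<alpha> = 1 - s"
    by (subst vi, use \<alpha>\<alpha> in \<open>simp add: s_def\<close>)+
  have ww: "(\<Sum>k<n. w k * cnj (w k)) = 2 * s"
  proof -
    have "(\<Sum>k<n. w k * cnj (w k)) =
      (\<Sum>k<n. v k * cnj (v k) + of_bool (k = i) * (1 - v i * cnj \<alpha> - cnj (v i) * \<alpha>))"
      by (intro sum.cong refl) (use \<alpha>\<alpha> in \<open>auto simp: w_def algebra_simps\<close>)
    also have "\<dots> = 1 + (1 - v i * cnj \<alpha> - cnj (v i) * \<alpha>)"
      using i by (simp add: sum.distrib vv sum_distrib_right[symmetric])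
    finally show ?thesis by (simp add: vv')
  qed
  \<comment> \<open>As \<open>2 * s\<close> is the squared norm of \<open>w\<close>, this is the reflection along \<open>w\<close>.\<close>
  define V where "V = mat n n (\<lambda>(j, k). of_bool (j = k) - w j * cnj (w k) / s)"
  have V: "V $$ (j, k) = of_bool (j = k) - w j * cnj (w k) / s" if "j < n" "k < n" for j k
    using that by (simp add: V_def)
  have Vc: "V \<in> carrier_mat n n" by (simp add: V_def)
  have herm: "cnj (V $$ (j, k)) = V $$ (k, j)" if "j < n" "k < n" for j k
    using that by (auto simp: V cs)
  have lin: "(\<Sum>m<n. of_bool (m = j) * a - of_bool (m = k) * b + d * (w m * cnj (w m))) = a - b + d * (2 * s)"
    if "j < n" "k < n" for j k a b d
  proof -
    have "(\<Sum>m<n. of_bool (m = j) * a) = a" "(\<Sum>m<n. of_bool (m = k) * b) = b"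
      using that by (simp_all add: sum_distrib_right[symmetric])
    thus ?thesis
      by (simp only: sum.distrib sum_subtractf sum_distrib_left[symmetric] ww)
  qed
  have sq: "(\<Sum>m<n. V $$ (j, m) * V $$ (m, k)) = of_bool (j = k)" if "j < n" "k < n" for j k
  proof -
    have "(\<Sum>m<n. V $$ (j, m) * V $$ (m, k)) =
      (\<Sum>m<n. of_bool (m = j) * (of_bool (j = k) - w j * cnj (w k) / s) 
         - of_bool (m = k) * (w j * cnj (w k) / s)
         + w j * cnj (w k) / s\<^sup>2 * (w m * cnj (w m)))"
      by (intro sum.cong refl) (use that s0 in \<open>auto simp: V field_simps power2_eq_square\<close>)
    also have "\<dots> = of_bool (j = k) - w j * cnj (w k) / s - w j * cnj (w k) / s
        + w j * cnj (w k) / s\<^sup>2 * (2 * s)"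
      by (rule lin[OF that])
    also have "\<dots> = of_bool (j = k)"
      using s0 by (simp add: field_simps power2_eq_square)
    finally show ?thesis .
  qed
  have "V \<in> unitary_group n"
    using sq herm Vc by (auto simp: unitary_group_iff)
  moreover have "V $$ (i, k) = \<alpha> * cnj (v k)" if "k < n" for k
  proof -
    have "V $$ (i, k) = of_bool (i = k) + \<alpha> * cnj (w k)"
      using that i s0 by (simp add: V wi)
    moreover have "\<alpha> * cnj (w k) = \<alpha> * cnj (v k) - of_bool (i = k)"
      using \<alpha>\<alpha> by (cases "i = k") (simp_all add: w_def right_diff_distrib)
    ultimately show ?thesis
      by simp
  qed
  ultimately show thesis
    using that \<alpha> by blast
qed

section \<open>Large entries under Haar measure\<close>

lemma measurable_mat_entry:
  assumes "i < n" "j < n"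
  shows "(\<lambda>A. A $$ (i, j)) \<in> borel_measurable (mat_borel n)"
proof -
  have "(\<lambda>A. \<lambda>ij\<in>{..<n} \<times> {..<n}. A $$ ij) \<in> mat_borel n \<rightarrow>\<^sub>M PiM ({..<n} \<times> {..<n}) (\<lambda>_. borel :: complex measure)"
    unfolding mat_borel_def by (rule measurable_vimage_algebra1) (auto simp: space_PiM)
  from measurable_compose[OF this measurable_component_singleton[of "(i, j)"]] show ?thesis
    using assms by simp
qed

lemma measurable_mat_borelI:
  assumes "\<And>x. x \<in> space M \<Longrightarrow> g x \<in> carrier_mat n n"
    and "\<And>i j. i < n \<Longrightarrow> j < n \<Longrightarrow> (\<lambda>x. g x $$ (i, j)) \<in> borel_measurable M"
  shows "g \<in> M \<rightarrow>\<^sub>M mat_borel n"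
  unfolding mat_borel_def
  by (rule measurable_vimage_algebra2) (use assms in \<open>auto intro!: measurable_restrict\<close>)

lemma space_haar:
  assumes "haar_unitary n \<mu>"
  shows "space \<mu> = unitary_group n"
proof -
  have "space \<mu> = space (restrict_space (mat_borel n) (unitary_group n))"
    using assms by (intro sets_eq_imp_space_eq) (simp add: haar_unitary_def)
  also have "\<dots> = unitary_group n"
    by (auto simp: space_restrict_space mat_borel_def unitary_group_def)
  finally show ?thesis .
qed

lemma measurable_haar_entry:
  assumes "haar_unitary n \<mu>" "i < n" "j < n"
  shows "(\<lambda>U. U $$ (i, j)) \<in> borel_measurable \<mu>"
proof -
  have "sets \<mu> = sets (restrict_space (mat_borel n) (unitary_group n))"
    using assms by (simp add: haar_unitary_def)
  from measurable_cong_sets[OF this refl, of "borel :: complex measure"] show ?thesis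
    by (simp add: measurable_restrict_space1[OF measurable_mat_entry[OF assms(2,3)]])
qed

lemma measurable_haar_left_mult:
  assumes \<mu>: "haar_unitary n \<mu>" and V: "V \<in> unitary_group n"
  shows "(\<lambda>U. V * U) \<in> \<mu> \<rightarrow>\<^sub>M \<mu>"
proof -
  have Vc: "V \<in> carrier_mat n n"
    using V by (simp add: unitary_group_def)
  have sp: "space \<mu> \<subseteq> carrier_mat n n"
    using space_haar[OF \<mu>] by (auto simp: unitary_group_def)
  have "(\<lambda>U. V * U) \<in> \<mu> \<rightarrow>\<^sub>M mat_borel n"
  proof (rule measurable_mat_borelI)
    fix i j assume ij: "i < n" "j < n"
    have "(\<lambda>U. \<Sum>k<n. V $$ (i, k) * U $$ (k, j)) \<in> borel_measurable \<mu>"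
      by (intro borel_measurable_sum borel_measurable_times borel_measurable_const
          measurable_haar_entry[OF \<mu>]) (use ij in auto)
    thus "(\<lambda>U. (V * U) $$ (i, j)) \<in> borel_measurable \<mu>"
      by (rule measurable_cong[THEN iffD1, rotated])
        (use sp ij in \<open>auto intro!: mult_mat_index_sum[OF Vc, symmetric]\<close>)
  qed (use sp Vc in auto)
  hence "(\<lambda>U. V * U) \<in> \<mu> \<rightarrow>\<^sub>M restrict_space (mat_borel n) (unitary_group n)"
    by (intro measurable_restrict_space2) (use V space_haar[OF \<mu>] unitary_mult_closed in auto)
  moreover have "sets \<mu> = sets (restrict_space (mat_borel n) (unitary_group n))"
    using \<mu> by (simp add: haar_unitary_def)
  ultimately show ?thesis
    using measurable_cong_sets[OF refl, of \<mu> "restrict_space (mat_borel n) (unitary_group n)" \<mu>] by simp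
qed

lemma haar_left_invariant:
  assumes \<mu>: "haar_unitary n \<mu>" and V: "V \<in> unitary_group n" and G: "G \<in> sets \<mu>"
  shows "measure \<mu> ((\<lambda>U. V * U) -` G \<inter> space \<mu>) = measure \<mu> G"
  using measure_distr[OF measurable_haar_left_mult[OF \<mu> V] G] \<mu> V
  by (simp add: haar_unitary_def)

text \<open>For unit vectors \<open>\<parallel>u - v\<parallel>\<^sup>2 = 2 - 2 Re \<langle>u, v\<rangle>\<close>, so distance \<open>1 / 2\<close> leaves an inner product of
  modulus at least \<open>7 / 8\<close>, whose square exceeds \<open>3 / 4\<close>.\<close>

lemma inner_product_of_close_unit_vectors:
  fixes u v :: "nat \<Rightarrow> complex"
  assumes u: "(\<Sum>k<n. (cmod (u k))\<^sup>2) = 1" and v: "(\<Sum>k<n. (cmod (v k))\<^sup>2) = 1"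
    and d: "(\<Sum>k<n. (cmod (u k - v k))\<^sup>2) \<le> 1 / 4"
  shows "3 / 4 \<le> (cmod (\<Sum>k<n. cnj (v k) * u k))\<^sup>2"
proof -
  let ?s = "\<Sum>k<n. cnj (v k) * u k"
  have "(cmod (u k - v k))\<^sup>2 = (cmod (u k))\<^sup>2 + (cmod (v k))\<^sup>2 - 2 * Re (cnj (v k) * u k)" for k
    by (simp only: cmod_power2) (simp add: power2_eq_square algebra_simps)
  hence "(\<Sum>k<n. (cmod (u k - v k))\<^sup>2) = 2 - 2 * Re ?s"
    by (simp add: sum.distrib sum_subtractf sum_distrib_left[symmetric] u v)
  hence "7 / 8 \<le> cmod ?s"
    using d complex_Re_le_cmod[of ?s] by linarith
  from power_mono[OF this, of 2] show ?thesis
    by (simp add: power2_eq_square)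
qed

text \<open>A lower bound of the form \<open>exp (- O (n log n))\<close> is enough for what follows, and it comes from
  invariance alone, by counting. Round the real and imaginary parts of a column to multiples of
  \<open>1 / (3 * n)\<close>: at most \<open>(6 * n + 1) ^ (2 * n)\<close> cells of the unit sphere result, and two columns
  in one cell are at distance at most \<open>1 / 2\<close>. A unitary that turns a representative of a cell
  into a unimodular multiple of the \<open>i\<close>-th basis vector therefore maps all matrices of that cell
  into the event in question, so the translates of the event by these unitaries cover the group. By left
  invariance all translates have the same probability.\<close>

lemma haar_prob_large_entry:
  assumes \<mu>: "haar_unitary n \<mu>" and i: "i < n" and j: "j < n"
  shows "1 / real (6 * n + 1) ^ (2 * n) \<le> measure \<mu> {U \<in> space \<mu>. 3 / 4 \<le> (cmod (U $$ (i, j)))\<^sup>2}"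
    (is "_ \<le> measure \<mu> ?G")
proof -
  interpret prob_space \<mu> using \<mu> by (simp add: haar_unitary_def)
  note sp = space_haar[OF \<mu>]
  have [measurable]: "(\<lambda>U. U $$ (i, j)) \<in> borel_measurable \<mu>"
    by (rule measurable_haar_entry[OF \<mu> i j])
  have G: "?G \<in> sets \<mu>" by measurable
  \<comment> \<open>This mesh makes the squared distance within a cell at most \<open>n * 2 / K\<^sup>2 \<le> 1 / 4\<close>.\<close>
  define K where "K = 3 * real n"
  have K: "K > 0" using i by (simp add: K_def)
  define cell where "cell U = (\<lambda>k\<in>{..<n}. (\<lfloor>K * Re (U $$ (k, j))\<rfloor>, \<lfloor>K * Im (U $$ (k, j))\<rfloor>))"
    for U :: "complex mat"
  define I where "I = {- int (3 * n)..int (3 * n)}"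
  let ?E = "PiE {..<n} (\<lambda>_. I \<times> I)"
  have cell: "cell ` unitary_group n \<subseteq> ?E"
  proof (rule image_subsetI)
    fix U assume U: "U \<in> unitary_group n"
    have "\<lfloor>K * Re (U $$ (k, j))\<rfloor> \<in> I \<and> \<lfloor>K * Im (U $$ (k, j))\<rfloor> \<in> I" if "k < n" for k
    proof -
      have "(cmod (U $$ (k, j)))\<^sup>2 \<le> 1"
        unfolding unitary_column_norm[OF U j, symmetric]
        by (rule member_le_sum) (use that in auto)
      hence "cmod (U $$ (k, j)) \<le> 1"
        by (simp add: power_le_one_iff)
      hence "\<bar>Re (U $$ (k, j))\<bar> \<le> 1" "\<bar>Im (U $$ (k, j))\<bar> \<le> 1"
        using abs_Re_le_cmod abs_Im_le_cmod order_trans by blast+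
      hence "\<bar>K * Re (U $$ (k, j))\<bar> \<le> K" "\<bar>K * Im (U $$ (k, j))\<bar> \<le> K"
        using K by (simp_all add: abs_mult)
      thus ?thesis
        by (auto simp: I_def K_def abs_le_iff le_floor_iff floor_le_iff)
    qed
    thus "cell U \<in> ?E"
      by (auto simp: cell_def)
  qed
  have fin: "finite ?E" by (simp add: finite_PiE I_def)
  have cardE: "card ?E = (6 * n + 1) ^ (2 * n)"
  proof -
    have "card I = 6 * n + 1" by (simp add: I_def)
    thus ?thesis
      by (simp add: card_PiE card_cartesian_product power_mult power2_eq_square)
  qed
  let ?C = "cell ` unitary_group n"
  have finC: "finite ?C" using fin cell finite_subset by blast
  have ex: "\<exists>V\<in>unitary_group n. \<forall>U\<in>unitary_group n. cell U = c \<longrightarrow> 3 / 4 \<le> (cmod ((V * U) $$ (i, j)))\<^sup>2"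
    if "c \<in> ?C" for c
  proof -
    from that obtain W where W: "W \<in> unitary_group n" "c = cell W" by blast
    obtain V \<alpha> where V: "V \<in> unitary_group n" "cmod \<alpha> = 1"
      "\<And>k. k < n \<Longrightarrow> V $$ (i, k) = \<alpha> * cnj (W $$ (k, j))"
      using unitary_with_row[OF unitary_column_norm[OF W(1) j] i] by metis
    have "3 / 4 \<le> (cmod ((V * U) $$ (i, j)))\<^sup>2" if U: "U \<in> unitary_group n" "cell U = c" for U
    proof -
      have close: "(cmod (U $$ (k, j) - W $$ (k, j)))\<^sup>2 \<le> 2 / K\<^sup>2" if k: "k < n" for k
      proof -
        have 1: "(x - y)\<^sup>2 \<le> 1 / K\<^sup>2" if "\<lfloor>K * x\<rfloor> = \<lfloor>K * y\<rfloor>" for x y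
        proof -
          have "\<bar>K * (x - y)\<bar> \<le> 1"
            using that by (simp add: right_diff_distrib) linarith
          hence "(K * (x - y))\<^sup>2 \<le> 1"
            by (simp add: abs_square_le_1)
          thus ?thesis
            using K by (simp add: power_mult_distrib pos_le_divide_eq mult.commute)
        qed
        have "cell U k = cell W k" using U W by simp
        hence "(Re (U $$ (k, j)) - Re (W $$ (k, j)))\<^sup>2 \<le> 1 / K\<^sup>2" "(Im (U $$ (k, j)) - Im (W $$ (k, j)))\<^sup>2 \<le> 1 / K\<^sup>2"
          using k 1 by (simp_all add: cell_def)
        thus ?thesis
          by (simp add: cmod_power2)
      qed
      have "(\<Sum>k<n. (cmod (U $$ (k, j) - W $$ (k, j)))\<^sup>2) \<le> real (card {..<n}) * (2 / K\<^sup>2)"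
        by (rule sum_bounded_above) (use close in auto)
      also have "\<dots> \<le> 1 / 4"
      proof -
        have "1 \<le> real n" using i by simp
        thus ?thesis by (simp add: K_def field_simps power2_eq_square)
      qed
      finally have "3 / 4 \<le> (cmod (\<Sum>k<n. cnj (W $$ (k, j)) * U $$ (k, j)))\<^sup>2"
        by (intro inner_product_of_close_unit_vectors unitary_column_norm W U j)
      also have "(V * U) $$ (i, j) = \<alpha> * (\<Sum>k<n. cnj (W $$ (k, j)) * U $$ (k, j))"
      proof -
        have "(V * U) $$ (i, j) = (\<Sum>k<n. V $$ (i, k) * U $$ (k, j))"
          using V(1) U(1) i j by (intro mult_mat_index_sum) (auto simp: unitary_group_def)
        thus ?thesis using V(3) by (simp add: sum_distrib_left mult.assoc)
      qed
      hence "cmod (\<Sum>k<n. cnj (W $$ (k, j)) * U $$ (k, j)) = cmod ((V * U) $$ (i, j))"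
        using V(2) by (simp add: norm_mult)
      finally show ?thesis .
    qed
    with V(1) show ?thesis by blast
  qed
  then obtain V where V: "\<And>c. c \<in> ?C \<Longrightarrow> V c \<in> unitary_group n"
    "\<And>c U. c \<in> ?C \<Longrightarrow> U \<in> unitary_group n \<Longrightarrow> cell U = c \<Longrightarrow> 3 / 4 \<le> (cmod ((V c * U) $$ (i, j)))\<^sup>2"
    by metis
  let ?pre = "\<lambda>c. (\<lambda>U. V c * U) -` ?G \<inter> space \<mu>"
  have pre: "?pre ` ?C \<subseteq> sets \<mu>"
    using V(1) G measurable_haar_left_mult[OF \<mu>] by (auto intro: measurable_sets)
  have "U \<in> ?pre (cell U)" if "U \<in> space \<mu>" for U
  proof -
    have U: "U \<in> unitary_group n" using that sp by simp
    hence C: "cell U \<in> ?C" by (rule imageI)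
    show ?thesis
      using V(2)[OF C U refl] unitary_mult_closed[OF V(1)[OF C] U] that by (simp add: sp)
  qed
  hence "space \<mu> \<subseteq> (\<Union>c\<in>?C. ?pre c)"
    by (intro subsetI UN_I[where a = "cell _"]) (rule imageI, simp add: sp, blast)
  hence "measure \<mu> (space \<mu>) \<le> measure \<mu> (\<Union>c\<in>?C. ?pre c)"
    by (rule finite_measure_mono) (rule sets.finite_Union[OF finite_imageI[OF finC] pre])
  hence "1 \<le> measure \<mu> (\<Union>c\<in>?C. ?pre c)"
    by (simp only: prob_space)
  also have "\<dots> \<le> (\<Sum>c\<in>?C. measure \<mu> (?pre c))"
    by (rule finite_measure_subadditive_finite[OF finC pre])
  also have "\<dots> = (\<Sum>c\<in>?C. measure \<mu> ?G)"
    by (rule sum.cong[OF refl]) (rule haar_left_invariant[OF \<mu> V(1) G])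
  also have "\<dots> = real (card ?C) * measure \<mu> ?G"
    by simp
  also have "\<dots> \<le> real (6 * n + 1) ^ (2 * n) * measure \<mu> ?G"
  proof (rule mult_right_mono)
    have "card ?C \<le> (6 * n + 1) ^ (2 * n)"
      using card_mono[OF fin cell] cardE by simp
    thus "real (card ?C) \<le> real (6 * n + 1) ^ (2 * n)"
      by (metis of_nat_le_iff of_nat_power)
  qed simp
  finally show ?thesis
    by (simp add: divide_le_eq mult.commute)
qed

section \<open>The Harish-Chandra integral in one variable\<close>

text \<open>This is the upper left entry of \<open>U\<^sup>* D\<^sub>a U\<close>. Since a column of a unitary matrix has norm one, it is
  an average of \<open>a\<close> with random weights.\<close>

definition weighted_mean :: "nat \<Rightarrow> (nat \<Rightarrow> real) \<Rightarrow> complex mat \<Rightarrow> real" where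
  "weighted_mean n a U = (\<Sum>i<n. a i * (cmod (U $$ (i, 0)))\<^sup>2)"

abbreviation first_point :: "complex \<Rightarrow> nat \<Rightarrow> complex" where
  "first_point z \<equiv> (\<lambda>_. 0)(0 := z)"

lemma mat_trace_diag_conjugate:
  assumes U: "U \<in> carrier_mat n n"
  shows "mat_trace (mat_diag n y * U * mat_diag n x * mat_adjoint U)
    = (\<Sum>i<n. \<Sum>k<n. y i * x k * of_real ((cmod (U $$ (i, k)))\<^sup>2))"
proof -
  have yU: "mat_diag n y * U = mat n n (\<lambda>(i, j). y i * U $$ (i, j))"
    by (rule mat_diag_mult_left[OF U])
  have yUx: "mat_diag n y * U * mat_diag n x = mat n n (\<lambda>(i, j). y i * U $$ (i, j) * x j)"
    unfolding yU by (subst mat_diag_mult_right[of _ n]) (auto intro!: eq_matI)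
  let ?M = "mat n n (\<lambda>(i, j). y i * U $$ (i, j) * x j)"
  have "mat_trace (?M * mat_adjoint U) = (\<Sum>i<n. \<Sum>k<n. ?M $$ (i, k) * mat_adjoint U $$ (k, i))"
    unfolding mat_trace_def
    by (intro sum.cong mult_mat_index_sum[OF _ mat_adjoint_carrier[OF U]]) auto
  also have "\<dots> = (\<Sum>i<n. \<Sum>k<n. y i * x k * of_real ((cmod (U $$ (i, k)))\<^sup>2))"
    by (intro sum.cong refl)
      (simp add: mat_adjoint_index[OF U] complex_norm_square del: of_real_power)
  finally show ?thesis
    unfolding yUx .
qed

text \<open>On the real axis the Harish-Chandra integral in one variable is the moment generating function of
  \<^const>\<open>weighted_mean\<close> under Haar measure; in particular it is real and positive.\<close>

lemma HC_first_point:
  assumes \<mu>: "haar_unitary n \<mu>" and n: "n \<ge> 1"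
  shows "HC \<mu> n (first_point (of_real t)) a = of_real (\<integral>U. exp (t * weighted_mean n a U) \<partial>\<mu>)"
proof -
  have "HC \<mu> n (first_point (of_real t)) a = (\<integral>U. of_real (exp (t * weighted_mean n a U)) \<partial>\<mu>)"
    unfolding HC_def
  proof (rule Bochner_Integration.integral_cong[OF refl])
    fix U assume "U \<in> space \<mu>"
    hence U: "U \<in> carrier_mat n n"
      by (simp add: space_haar[OF \<mu>] unitary_group_def)
    have "(\<Sum>k<n. complex_of_real (a i) * first_point (of_real t) k * of_real ((cmod (U $$ (i, k)))\<^sup>2))
        = of_real (t * (a i * (cmod (U $$ (i, 0)))\<^sup>2))" for i
    proof -
      have "(\<Sum>k<n. complex_of_real (a i) * first_point (of_real t) k * of_real ((cmod (U $$ (i, k)))\<^sup>2))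
        = (\<Sum>k<n. if k = 0 then of_real (t * (a i * (cmod (U $$ (i, 0)))\<^sup>2)) else 0)"
        by (intro sum.cong refl) auto
      thus ?thesis using n by (simp del: of_real_mult)
    qed
    thus "exp (mat_trace (mat_diag n (\<lambda>i. complex_of_real (a i)) * U * mat_diag n (first_point (of_real t)) * mat_adjoint U))
        = of_real (exp (t * weighted_mean n a U))"
      by (simp only: mat_trace_diag_conjugate[OF U] weighted_mean_def sum_distrib_left of_real_sum[symmetric] exp_of_real)
  qed
  thus ?thesis
    by simp
qed

text \<open>When the most deviating \<open>a i\<close> carries weight at least \<open>3 / 4\<close>, the others can cancel at most a
  third of its contribution, because their deviations are no larger and their total weight is at
  most \<open>1 / 4\<close>. With the index of the largest or smallest \<open>a i\<close> instead, a far outlier on the other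
  side could cancel it.\<close>

lemma weighted_mean_deviation:
  assumes U: "U \<in> unitary_group n" and i: "i < n"
    and max: "\<And>k. k < n \<Longrightarrow> \<bar>a k - c\<bar> \<le> \<bar>a i - c\<bar>"
    and large: "3 / 4 \<le> (cmod (U $$ (i, 0)))\<^sup>2"
  shows "\<bar>a i - c\<bar> / 2 \<le> \<bar>weighted_mean n a U - c\<bar>"
proof -
  define w where "w k = (cmod (U $$ (k, 0)))\<^sup>2" for k
  have w1: "(\<Sum>k<n. w k) = 1"
    unfolding w_def by (rule unitary_column_norm[OF U]) (use i in simp)
  have w0: "w k \<ge> 0" for k by (simp add: w_def)
  have "weighted_mean n a U - c = (\<Sum>k<n. a k * w k) - c * (\<Sum>k<n. w k)"
    by (simp add: weighted_mean_def w1) (simp add: w_def)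
  also have "\<dots> = (\<Sum>k<n. (a k - c) * w k)"
    by (simp add: sum_distrib_left sum_subtractf algebra_simps)
  also have "\<dots> = (a i - c) * w i + (\<Sum>k\<in>{..<n} - {i}. (a k - c) * w k)"
    using i by (subst sum.remove[of _ i]) auto
  finally have eq: "weighted_mean n a U - c = \<dots>" .
  have "\<bar>\<Sum>k\<in>{..<n} - {i}. (a k - c) * w k\<bar> \<le> (\<Sum>k\<in>{..<n} - {i}. \<bar>a i - c\<bar> * w k)"
    by (rule order_trans[OF sum_abs sum_mono]) (use max w0 in \<open>auto simp: abs_mult intro!: mult_right_mono\<close>)
  also have "\<dots> = \<bar>a i - c\<bar> * (1 - w i)"
    using w1 sum.remove[of "{..<n}" i w] i by (simp add: sum_distrib_left[symmetric])
  finally have "\<bar>a i - c\<bar> * w i - \<bar>a i - c\<bar> * (1 - w i) \<le> \<bar>weighted_mean n a U - c\<bar>"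
    unfolding eq using w0[of i] abs_mult[of "a i - c" "w i"] by simp
  moreover have "\<bar>a i - c\<bar> * (3 / 4) \<le> \<bar>a i - c\<bar> * w i"
    using large by (intro mult_left_mono) (auto simp: w_def)
  ultimately show ?thesis
    by (simp add: algebra_simps)
qed

lemma borel_measurable_weighted_mean:
  assumes "haar_unitary n \<mu>" "n \<ge> 1"
  shows "weighted_mean n a \<in> borel_measurable \<mu>"
proof -
  have [measurable]: "(\<lambda>U. U $$ (i, 0)) \<in> borel_measurable \<mu>" if "i < n" for i
    using assms that by (intro measurable_haar_entry) auto
  show ?thesis
    unfolding weighted_mean_def
    by (intro borel_measurable_sum borel_measurable_times borel_measurable_const borel_measurable_power borel_measurable_norm) auto
qed

lemma integrable_exp_weighted_mean:
  assumes \<mu>: "haar_unitary n \<mu>" and n: "n \<ge> 1"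
  shows "integrable \<mu> (\<lambda>U. exp (t * weighted_mean n a U))"
proof -
  interpret prob_space \<mu> using \<mu> by (simp add: haar_unitary_def)
  have [measurable]: "weighted_mean n a \<in> borel_measurable \<mu>"
    by (rule borel_measurable_weighted_mean[OF \<mu> n])
  have *: "\<bar>weighted_mean n a U\<bar> \<le> (\<Sum>i<n. \<bar>a i\<bar>)" if "U \<in> space \<mu>" for U
  proof -
    have U: "U \<in> unitary_group n" using that space_haar[OF \<mu>] by simp
    have w: "(cmod (U $$ (i, 0)))\<^sup>2 \<le> 1" if "i < n" for i
      unfolding unitary_column_norm[OF U, of 0, symmetric, OF n[unfolded One_nat_def Suc_le_eq]]
      by (rule member_le_sum) (use that in auto)
    show ?thesis
      unfolding weighted_mean_def
      by (rule order_trans[OF sum_abs sum_mono])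
        (use w in \<open>auto simp: abs_mult intro!: mult_left_le\<close>)
  qed
  have "t * weighted_mean n a U \<le> \<bar>t\<bar> * (\<Sum>i<n. \<bar>a i\<bar>)" if "U \<in> space \<mu>" for U
  proof -
    have "\<bar>t * weighted_mean n a U\<bar> \<le> \<bar>t\<bar> * (\<Sum>i<n. \<bar>a i\<bar>)"
      using *[OF that] by (simp add: abs_mult mult_left_mono)
    thus ?thesis by linarith
  qed
  hence "AE U in \<mu>. norm (exp (t * weighted_mean n a U)) \<le> exp (\<bar>t\<bar> * (\<Sum>i<n. \<bar>a i\<bar>))"
    by (intro AE_I2) simp
  thus ?thesis
    by (intro integrable_const_bound) auto
qed

text \<open>The right hand side is the Haar integral of \<open>exp (t * (Z - c)) + exp (- t * (Z - c))\<close>, where \<open>Z\<close> is the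
  weighted mean. It dominates \<open>exp (t * \<bar>Z - c\<bar>)\<close>, whatever the sign of the deviation, and this
  is large on the event of \<open>haar_prob_large_entry\<close> for the index of largest deviation.\<close>

lemma HC_symmetrized_lower_bound:
  assumes \<mu>: "haar_unitary n \<mu>" and i: "i < n" and t: "t \<ge> 0"
  shows "exp (t * \<bar>a i - c\<bar> / 2) / real (6 * n + 1) ^ (2 * n)
    \<le> exp (- t * c) * Re (HC \<mu> n (first_point (of_real t)) a)
      + exp (t * c) * Re (HC \<mu> n (first_point (of_real (- t))) a)"
proof -
  interpret prob_space \<mu> using \<mu> by (simp add: haar_unitary_def)
  have n: "n \<ge> 1" using i by simp
  note sp = space_haar[OF \<mu>]
  obtain m where m: "m < n" "\<And>k. k < n \<Longrightarrow> \<bar>a k - c\<bar> \<le> \<bar>a m - c\<bar>"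
  proof -
    have "Max ((\<lambda>k. \<bar>a k - c\<bar>) ` {..<n}) \<in> (\<lambda>k. \<bar>a k - c\<bar>) ` {..<n}"
      using i by (intro Max_in) auto
    then obtain m where "m < n" "Max ((\<lambda>k. \<bar>a k - c\<bar>) ` {..<n}) = \<bar>a m - c\<bar>"
      by auto
    with that show thesis
      by (metis Max_ge finite_imageI finite_lessThan imageI lessThan_iff)
  qed
  let ?G = "{U \<in> space \<mu>. 3 / 4 \<le> (cmod (U $$ (m, 0)))\<^sup>2}"
  let ?Z = "weighted_mean n a"
  let ?f = "\<lambda>U. exp (- t * c) * exp (t * ?Z U) + exp (t * c) * exp (- t * ?Z U)"
  have [measurable]: "(\<lambda>U. U $$ (m, 0)) \<in> borel_measurable \<mu>"
    using measurable_haar_entry[OF \<mu> m(1)] n by simp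
  have G: "?G \<in> sets \<mu>" by measurable
  have int: "integrable \<mu> ?f"
    by (intro Bochner_Integration.integrable_add integrable_mult_right integrable_exp_weighted_mean \<mu> n)
  have "exp (t * \<bar>a i - c\<bar> / 2) / real (6 * n + 1) ^ (2 * n)
      \<le> exp (t * \<bar>a m - c\<bar> / 2) * (1 / real (6 * n + 1) ^ (2 * n))"
    using m(2)[OF i] t by (simp add: mult_left_mono divide_right_mono)
  also have "\<dots> \<le> exp (t * \<bar>a m - c\<bar> / 2) * measure \<mu> ?G"
    using haar_prob_large_entry[OF \<mu> m(1), of 0] n by (intro mult_left_mono) auto
  also have "\<dots> = (\<integral>U. exp (t * \<bar>a m - c\<bar> / 2) * indicator ?G U \<partial>\<mu>)"
    using G by simp
  also have "\<dots> \<le> (\<integral>U. ?f U \<partial>\<mu>)"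
  proof (rule integral_mono[OF _ int])
    show "integrable \<mu> (\<lambda>U. exp (t * \<bar>a m - c\<bar> / 2) * indicator ?G U)"
      using G by (intro integrable_mult_right integrable_real_indicator) (auto simp: emeasure_eq_measure)
    fix U assume U: "U \<in> space \<mu>"
    have f: "?f U = exp (t * (?Z U - c)) + exp (- (t * (?Z U - c)))"
      by (simp add: mult_exp_exp algebra_simps)
    show "exp (t * \<bar>a m - c\<bar> / 2) * indicator ?G U \<le> ?f U"
    proof (cases "U \<in> ?G")
      case True
      have "\<bar>a m - c\<bar> / 2 \<le> \<bar>?Z U - c\<bar>"
        by (rule weighted_mean_deviation[where i = m]) (use True sp m in auto)
      hence "t * \<bar>a m - c\<bar> / 2 \<le> \<bar>t * (?Z U - c)\<bar>"
        using t mult_left_mono[of "\<bar>a m - c\<bar> / 2" "\<bar>?Z U - c\<bar>" t] by (simp add: abs_mult)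
      hence "exp (t * \<bar>a m - c\<bar> / 2) \<le> exp \<bar>t * (?Z U - c)\<bar>"
        by simp
      also have "\<dots> \<le> ?f U"
        unfolding f by (simp add: abs_real_def)
      finally show ?thesis
        using True by simp
    next
      case False
      thus ?thesis by (simp add: add_nonneg_nonneg)
    qed
  qed
  also have "\<dots> = exp (- t * c) * (\<integral>U. exp (t * ?Z U) \<partial>\<mu>) + exp (t * c) * (\<integral>U. exp (- t * ?Z U) \<partial>\<mu>)"
    using integrable_exp_weighted_mean[OF \<mu> n, of t a] integrable_exp_weighted_mean[OF \<mu> n, of "- t" a]
    by (subst Bochner_Integration.integral_add) simp_all
  finally show ?thesis
    unfolding HC_first_point[OF \<mu> n] by simp
qed

text \<open>Markov's inequality for the symmetrized Harish-Chandra integral. The set \<open>B\<close>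
  lies in a superlevel set of that integral, which is measurable because the integral is integrable
  as a function of \<open>\<omega>\<close>.\<close>

lemma deviation_probability_bound:
  fixes X :: "'w \<Rightarrow> nat \<Rightarrow> real"
  assumes \<mu>: "haar_unitary n \<mu>" and n: "n \<ge> 1" and P: "prob_space P" and t: "t \<ge> 0"
    and int: "integrable P (\<lambda>\<omega>. HC \<mu> n (first_point (of_real t)) (X \<omega>))"
      "integrable P (\<lambda>\<omega>. HC \<mu> n (first_point (of_real (- t))) (X \<omega>))"
    and B: "\<And>\<omega>. \<omega> \<in> B \<Longrightarrow> \<omega> \<in> space P \<and> (\<exists>i<n. d \<le> \<bar>X \<omega> i - c\<bar>)"
  shows "measure P B \<le> real (6 * n + 1) ^ (2 * n) * exp (- t * d / 2)
    * (exp (- t * c) * Re (\<integral>\<omega>. HC \<mu> n (first_point (of_real t)) (X \<omega>) \<partial>P)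
      + exp (t * c) * Re (\<integral>\<omega>. HC \<mu> n (first_point (of_real (- t))) (X \<omega>) \<partial>P))"
proof -
  interpret prob_space P by fact
  let ?H = "\<lambda>\<omega>. exp (- t * c) * Re (HC \<mu> n (first_point (of_real t)) (X \<omega>))
    + exp (t * c) * Re (HC \<mu> n (first_point (of_real (- t))) (X \<omega>))"
  let ?M = "real (6 * n + 1) ^ (2 * n)"
  have intH: "integrable P ?H"
    by (intro Bochner_Integration.integrable_add integrable_mult_right integrable_Re int)
  have EH: "(\<integral>\<omega>. ?H \<omega> \<partial>P) = exp (- t * c) * Re (\<integral>\<omega>. HC \<mu> n (first_point (of_real t)) (X \<omega>) \<partial>P)
      + exp (t * c) * Re (\<integral>\<omega>. HC \<mu> n (first_point (of_real (- t))) (X \<omega>) \<partial>P)"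
    using int by (simp add: integrable_Re)
  have H: "exp (t * \<bar>X \<omega> i - c\<bar> / 2) / ?M \<le> ?H \<omega>" if "i < n" for i \<omega>
    using HC_symmetrized_lower_bound[OF \<mu> that t, of "X \<omega>" c] .
  have M: "?M > 0" by simp
  have "measure P B \<le> measure P {\<omega> \<in> space P. ?H \<omega> \<ge> exp (t * d / 2) / ?M}"
  proof (rule finite_measure_mono)
    show "B \<subseteq> {\<omega> \<in> space P. ?H \<omega> \<ge> exp (t * d / 2) / ?M}"
    proof
      fix \<omega> assume "\<omega> \<in> B"
      from B[OF this] obtain i where i: "\<omega> \<in> space P" "i < n" "d \<le> \<bar>X \<omega> i - c\<bar>" by blast
      have "exp (t * d / 2) / ?M \<le> exp (t * \<bar>X \<omega> i - c\<bar> / 2) / ?M"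
        using i t by (intro divide_right_mono) (auto intro: mult_left_mono)
      thus "\<omega> \<in> {\<omega> \<in> space P. ?H \<omega> \<ge> exp (t * d / 2) / ?M}"
        using H[OF i(2), of \<omega>] i(1) by simp
    qed
    show "{\<omega> \<in> space P. ?H \<omega> \<ge> exp (t * d / 2) / ?M} \<in> sets P"
      using borel_measurable_integrable[OF intH] by measurable
  qed
  also have "\<dots> \<le> (\<integral>\<omega>. ?H \<omega> \<partial>P) / (exp (t * d / 2) / ?M)"
  proof (rule integral_Markov_inequality_measure[OF intH sets.empty_sets])
    have "0 \<le> ?H \<omega>" for \<omega>
      by (rule order_trans[OF _ H[of 0]]) (use n in auto)
    thus "AE \<omega> in P. 0 \<le> ?H \<omega>" by simp
  qed simp
  also have "\<dots> = ?M * exp (- t * d / 2) * (\<integral>\<omega>. ?H \<omega> \<partial>P)"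
    by (simp add: exp_minus field_simps)
  finally show ?thesis
    unfolding EH .
qed

section \<open>Power sums of eigenvalues\<close>

lemma mat_trace_mult_comm:
  assumes "A \<in> carrier_mat n m" "B \<in> carrier_mat m n"
  shows "mat_trace (A * B) = mat_trace (B * A)"
proof -
  have "mat_trace (A * B) = (\<Sum>i<n. \<Sum>k<m. A $$ (i, k) * B $$ (k, i))"
    unfolding mat_trace_def
    by (intro sum.cong mult_mat_index_sum[OF assms]) (use assms in auto)
  also have "\<dots> = (\<Sum>k<m. \<Sum>i<n. B $$ (k, i) * A $$ (i, k))"
    by (subst sum.swap) (simp add: mult.commute)
  also have "\<dots> = mat_trace (B * A)"
    unfolding mat_trace_def
    by (intro sum.cong mult_mat_index_sum[OF assms(2,1), symmetric]) (use assms in auto)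
  finally show ?thesis .
qed

lemma mat_trace_similar:
  assumes "similar_mat_wit A B P Q"
  shows "mat_trace A = mat_trace B"
proof -
  define n where "n = dim_row A"
  note w = similar_mat_witD[OF n_def assms]
  have "mat_trace A = mat_trace (P * (B * Q))"
    using w by (simp add: assoc_mult_mat[of _ n n _ n _ n])
  also have "\<dots> = mat_trace (B * Q * P)"
    by (rule mat_trace_mult_comm) (use w in auto)
  also have "B * Q * P = B"
    using w by (simp add: assoc_mult_mat[of _ n n _ n _ n])
  finally show ?thesis .
qed

lemma upper_triangular_pow:
  fixes B :: "complex mat"
  assumes B: "B \<in> carrier_mat n n" and ut: "upper_triangular B"
  shows "j \<le> i \<Longrightarrow> i < n \<Longrightarrow> (B ^\<^sub>m k) $$ (i, j) = (if i = j then (B $$ (i, i)) ^ k else 0)"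
proof (induction k arbitrary: i j)
  case 0
  thus ?case using B by auto
next
  case (Suc k)
  have Bk: "B ^\<^sub>m k \<in> carrier_mat n n" using B by simp
  have "(B ^\<^sub>m k * B) $$ (i, j) = (\<Sum>m<n. (B ^\<^sub>m k) $$ (i, m) * B $$ (m, j))"
    by (rule mult_mat_index_sum[OF Bk B]) (use Suc.prems in auto)
  also have "\<dots> = (\<Sum>m<n. if m = i then (B $$ (i, i)) ^ k * B $$ (i, j) else 0)"
  proof (intro sum.cong refl)
    fix m assume "m \<in> {..<n}"
    hence m: "m < n" by simp
    show "(B ^\<^sub>m k) $$ (i, m) * B $$ (m, j) = (if m = i then (B $$ (i, i)) ^ k * B $$ (i, j) else 0)"
    proof (cases "m \<le> i")
      case True
      thus ?thesis using Suc.IH[OF True] Suc.prems by simp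
    next
      case False
      hence "B $$ (m, j) = 0"
        using B Suc.prems m by (intro upper_triangularD[OF ut]) auto
      thus ?thesis using False by simp
    qed
  qed
  also have "\<dots> = (B $$ (i, i)) ^ k * B $$ (i, j)"
    using Suc.prems by simp
  also have "\<dots> = (if i = j then (B $$ (i, i)) ^ Suc k else 0)"
    using upper_triangularD[OF ut, of j i] B Suc.prems by (auto simp: mult.commute)
  finally show ?case
    by simp
qed

lemma hermitian_char_poly_root_real:
  assumes A: "A \<in> hermitian_mats n" and e: "poly (char_poly A) e = 0"
  shows "complex_of_real (Re e) = e"
proof -
  have Ac: "A \<in> carrier_mat n n" and adj: "mat_adjoint A = A"
    using A by (auto simp: hermitian_mats_def)
  have cA: "cnj (A $$ (i, j)) = A $$ (j, i)" if "i < n" "j < n" for i j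
    using mat_adjoint_index[OF Ac that(2,1)] adj by simp
  obtain v where v: "v \<in> carrier_vec n" "v \<noteq> 0\<^sub>v n" "A *\<^sub>v v = e \<cdot>\<^sub>v v"
    using e Ac unfolding eigenvalue_root_char_poly[OF Ac, symmetric] eigenvalue_def eigenvector_def
    by auto
  define f where "f = vec_index v"
  have ev: "(\<Sum>j<n. A $$ (i, j) * f j) = e * f i" if "i < n" for i
  proof -
    have "vec_index (A *\<^sub>v v) i = (\<Sum>j<n. A $$ (i, j) * f j)"
      using that Ac v(1) by (auto simp: scalar_prod_def f_def atLeast0LessThan intro!: sum.cong)
    thus ?thesis
      using that v by (simp add: f_def)
  qed
  define s where "s = (\<Sum>i<n. (cmod (f i))\<^sup>2)"
  have s: "complex_of_real s = (\<Sum>i<n. cnj (f i) * f i)"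
    by (simp add: s_def complex_norm_square mult.commute del: of_real_power)
  have "v = 0\<^sub>v n" if "\<forall>i<n. f i = 0"
    using that v(1) by (intro eq_vecI) (auto simp: f_def)
  then obtain i where i: "i < n" "f i \<noteq> 0"
    using v(2) by blast
  have "s > 0"
    unfolding s_def by (rule sum_pos2[of _ i]) (use i in auto)
  define q where "q = (\<Sum>i<n. \<Sum>j<n. cnj (f i) * A $$ (i, j) * f j)"
  have q: "q = e * s"
    unfolding q_def s by (simp add: mult.assoc sum_distrib_left[symmetric] ev) (simp add: sum_distrib_left ac_simps)
  have "cnj q = (\<Sum>i<n. \<Sum>j<n. cnj (f j) * A $$ (j, i) * f i)"
    by (simp add: q_def cA mult.commute mult.left_commute)
  also have "\<dots> = q"
    unfolding q_def by (rule sum.swap)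
  finally have "cnj e = e"
    unfolding q using \<open>s > 0\<close> by simp
  thus ?thesis
    by (simp add: complex_eq_iff)
qed

text \<open>The power sums of the eigenvalues are polynomials in the matrix entries, which is how they are seen
  to be measurable functions of the matrix. Triangularization reduces the identity to the diagonal
  of a power of a triangular matrix; as the roots are real, one may drop the \<^const>\<open>Re\<close> in
  \<^const>\<open>eigval\<close>.\<close>

lemma sum_eigval_power_eq_trace:
  assumes A: "A \<in> hermitian_mats n"
  shows "(\<Sum>i<n. complex_of_real (eigval A i) ^ k) = mat_trace (A ^\<^sub>m k)"
proof -
  have Ac: "A \<in> carrier_mat n n"
    using A by (simp add: hermitian_mats_def)
  obtain es0 where "char_poly A = (\<Prod>a\<leftarrow>es0. [:- a, 1:])"
    using char_poly_factorized[OF Ac] by blast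
  from schur_decomposition_exists[OF Ac this]
  obtain B where B: "B \<in> carrier_mat n n" "upper_triangular B" "similar_mat A B" by blast
  obtain P Q where wit: "similar_mat_wit A B P Q"
    using B(3) by (auto simp: similar_mat_def)
  define es where "es = diag_mat B"
  have len: "length es = n" and nth: "\<And>i. i < n \<Longrightarrow> es ! i = B $$ (i, i)"
    using B(1) by (simp_all add: es_def diag_mat_def)
  have cp: "char_poly A = (\<Prod>a\<leftarrow>es. [:- a, 1:])"
    using char_poly_similar[OF B(3)] char_poly_upper_triangular[OF B(1,2)] by (simp add: es_def)
  have nz: "(\<Prod>a\<leftarrow>xs. [:- a, 1:]) \<noteq> 0" for xs :: "complex list"
    by (auto simp: prod_list_zero_iff)
  have "proots (\<Prod>a\<leftarrow>xs. [:- a, 1:]) = mset xs" for xs :: "complex list"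
  proof (induction xs)
    case (Cons a xs)
    have "proots ([:- a, 1:] * (\<Prod>a\<leftarrow>xs. [:- a, 1:])) = proots [:- a, 1:] + proots (\<Prod>a\<leftarrow>xs. [:- a, 1:])"
      by (rule proots_mult[OF _ nz]) simp
    thus ?case
      using Cons by (simp del: mult_pCons_left)
  qed simp
  hence roots: "proots (char_poly A) = mset es"
    by (simp add: cp)
  have re: "complex_of_real (Re e) = e" if "e \<in> set es" for e
  proof (rule hermitian_char_poly_root_real[OF A])
    have "char_poly A \<noteq> 0"
      unfolding cp by (rule nz)
    moreover have "e \<in># proots (char_poly A)"
      using that by (simp add: roots)
    ultimately show "poly (char_poly A) e = 0"
      by simp
  qed
  define es' where "es' = sorted_list_of_multiset (image_mset Re (proots (char_poly A)))"
  have es': "mset es' = mset (map Re es)"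
    by (simp add: es'_def roots)
  have len': "length es' = n"
    using mset_eq_length[OF es'] len by simp
  have "(\<Sum>i<n. complex_of_real (eigval A i) ^ k) = sum_list (map (\<lambda>x. complex_of_real x ^ k) es')"
    by (simp add: sum_list_sum_nth len' eigval_def es'_def[symmetric] atLeast0LessThan)
  also have "\<dots> = sum_list (map (\<lambda>x. complex_of_real x ^ k) (map Re es))"
    unfolding sum_mset_sum_list[symmetric] mset_map es' ..
  also have "\<dots> = sum_list (map (\<lambda>e. e ^ k) es)"
    unfolding map_map comp_def by (intro arg_cong[of _ _ sum_list] map_cong refl) (simp only: re)
  also have "\<dots> = (\<Sum>i<n. (B ^\<^sub>m k) $$ (i, i))"
    by (simp add: sum_list_sum_nth len atLeast0LessThan nth upper_triangular_pow[OF B(1,2)])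
  also have "\<dots> = mat_trace (B ^\<^sub>m k)"
    using B(1) by (simp add: mat_trace_def)
  also have "\<dots> = mat_trace (A ^\<^sub>m k)"
    by (rule mat_trace_similar[OF similar_mat_wit_pow[OF wit], symmetric])
  finally show ?thesis .
qed

lemma borel_measurable_trace_pow:
  assumes A: "A \<in> P \<rightarrow>\<^sub>M mat_borel n"
  shows "(\<lambda>\<omega>. mat_trace (A \<omega> ^\<^sub>m k)) \<in> borel_measurable P"
proof -
  have Ac: "A \<omega> \<in> carrier_mat n n" if "\<omega> \<in> space P" for \<omega>
    using measurable_space[OF A that] by (simp add: mat_borel_def)
  have "(\<lambda>\<omega>. (A \<omega> ^\<^sub>m k) $$ (i, j)) \<in> borel_measurable P" if "i < n" "j < n" for i j
    using that
  proof (induction k arbitrary: i j)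
    case 0
    have "(\<lambda>\<omega>. of_bool (i = j) :: complex) \<in> borel_measurable P" by simp
    thus ?case
      by (rule measurable_cong[THEN iffD1, rotated]) (use Ac 0 in force)
  next
    case (Suc k)
    have "(\<lambda>\<omega>. \<Sum>m<n. (A \<omega> ^\<^sub>m k) $$ (i, m) * A \<omega> $$ (m, j)) \<in> borel_measurable P"
      by (intro borel_measurable_sum borel_measurable_times Suc.IH
          measurable_compose[OF A measurable_mat_entry]) (use Suc.prems in auto)
    thus ?case
    proof (rule measurable_cong[THEN iffD1, rotated])
      fix \<omega> assume "\<omega> \<in> space P"
      from Ac[OF this] have "A \<omega> ^\<^sub>m k \<in> carrier_mat n n" "A \<omega> \<in> carrier_mat n n" by simp_all
      from mult_mat_index_sum[OF this Suc.prems]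
      show "(\<Sum>m<n. (A \<omega> ^\<^sub>m k) $$ (i, m) * A \<omega> $$ (m, j)) = (A \<omega> ^\<^sub>m Suc k) $$ (i, j)"
        by simp
    qed
  qed
  hence "(\<lambda>\<omega>. \<Sum>i<n. (A \<omega> ^\<^sub>m k) $$ (i, i)) \<in> borel_measurable P"
    by (intro borel_measurable_sum) auto
  thus ?thesis
    by (rule measurable_cong[THEN iffD1, rotated]) (use Ac in \<open>auto simp: mat_trace_def\<close>)
qed

section \<open>Concentration of the eigenvalues\<close>

text \<open>This is where \<open>l > 1\<close> enters: the entropy \<open>2 N log (6 N + 1)\<close> of the covering is negligible against
  \<open>N powr l\<close>.\<close>

lemma superexponential_decay:
  fixes l \<kappa> :: real
  assumes "l > 1" "\<kappa> > 0"
  shows "(\<lambda>N. real (6 * N + 1) ^ (2 * N) * exp (- \<kappa> * real N powr l)) \<longlonglongrightarrow> 0"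
  using assms unfolding of_nat_add of_nat_mult of_nat_numeral of_nat_1 by real_asymp

lemma first_point_in_polydisc0: "cmod z < \<epsilon> \<Longrightarrow> first_point z \<in> polydisc0 1 \<epsilon>"
  by (auto simp: polydisc0_def)

text \<open>Where \<open>F\<close> is real, the imaginary part of its logarithm lies in the discrete set \<open>\<pi> \<int>\<close>; being
  continuous along the real segment and zero at the origin, it vanishes.\<close>

lemma log_branch_real_on_reals:
  fixes s :: real
  assumes L: "log_branch (polydisc0 1 \<epsilon>) F L"
    and F: "\<And>s::real. \<bar>s\<bar> < \<epsilon> \<Longrightarrow> Im (F (first_point (of_real s))) = 0"
    and s: "\<bar>s\<bar> < \<epsilon>"
  shows "Im (L (first_point (of_real s))) = 0"
proof -
  define g where "g u = Im (L (first_point (complex_of_real u)))" for u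
  let ?I = "{-\<epsilon><..<\<epsilon>}"
  have cont: "continuous_on ?I g"
  proof -
    have point: "continuous_on ?I (\<lambda>u. first_point (complex_of_real u))"
    proof (rule continuous_on_coordinatewise_then_product)
      fix i :: nat
      show "continuous_on ?I (\<lambda>u. first_point (complex_of_real u) i)"
        by (cases "i = 0") (auto intro!: continuous_intros)
    qed
    have "continuous_on (polydisc0 1 \<epsilon>) L"
      using L by (simp add: log_branch_def)
    hence "continuous_on ?I (\<lambda>u. L (first_point (complex_of_real u)))"
      by (rule continuous_on_compose2[OF _ point])
        (auto simp: abs_less_iff simp del: One_nat_def intro!: first_point_in_polydisc0)
    thus ?thesis
      unfolding g_def by (intro continuous_intros)
  qed
  have int: "\<exists>m::int. g u = m * pi" if "u \<in> ?I" for u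
  proof -
    let ?x = "first_point (complex_of_real u)"
    have "\<bar>u\<bar> < \<epsilon>" using that by auto
    hence "?x \<in> polydisc0 1 \<epsilon>" "Im (F ?x) = 0"
      by (auto simp del: One_nat_def intro!: first_point_in_polydisc0 F)
    hence "Im (exp (L ?x)) = 0"
      using L by (simp add: log_branch_def)
    hence "sin (g u) = 0"
      by (simp add: Im_exp g_def)
    thus ?thesis
      by (simp add: sin_zero_iff_int2)
  qed
  have "g constant_on ?I"
  proof (rule continuous_discrete_range_constant[OF _ cont])
    fix x assume x: "x \<in> ?I"
    have "pi \<le> norm (g y - g x)" if y: "y \<in> ?I" "g y \<noteq> g x" for y
    proof -
      obtain m k :: int where mk: "g y = m * pi" "g x = k * pi"
        using int[OF x] int[OF y(1)] by blast
      hence "m \<noteq> k" using y(2) by auto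
      hence "1 \<le> \<bar>real_of_int (m - k)\<bar>" by linarith
      hence "1 * pi \<le> \<bar>real_of_int (m - k)\<bar> * pi"
        by (intro mult_right_mono) auto
      also have "\<dots> = norm (g y - g x)"
        by (simp add: mk left_diff_distrib[symmetric] abs_mult)
      finally show ?thesis by simp
    qed
    thus "\<exists>e>0. \<forall>y. y \<in> ?I \<and> g y \<noteq> g x \<longrightarrow> e \<le> norm (g y - g x)"
      using pi_gt_zero by blast
  qed simp
  moreover have "0 \<in> ?I" "s \<in> ?I"
    using s by auto
  moreover have "g 0 = 0"
  proof -
    have "first_point (complex_of_real 0) = (\<lambda>_. 0)" by auto
    thus ?thesis using L by (simp add: g_def log_branch_def)
  qed
  ultimately have "g s = 0"
    by (metis constant_on_def)
  thus ?thesis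
    by (simp add: g_def)
qed

lemma deriv_real_of_real_on_reals:
  assumes f: "(f has_field_derivative D) (at 0)" and f0: "f 0 = 0"
    and \<epsilon>: "\<epsilon> > 0" and re: "\<And>s::real. \<bar>s\<bar> < \<epsilon> \<Longrightarrow> Im (f (of_real s)) = 0"
  shows "Im D = 0"
proof -
  have "((\<lambda>h. f h / h) \<longlongrightarrow> D) (at 0)"
    using f by (simp add: DERIV_def f0)
  moreover have "filterlim complex_of_real (at 0) (at (0::real))"
    by (auto simp: filterlim_at eventually_at_filter intro!: tendsto_eq_intros)
  ultimately have "((\<lambda>s. f (of_real s) / of_real s) \<longlongrightarrow> D) (at (0::real))"
    by (rule filterlim_compose)
  hence "((\<lambda>s. Im (f (of_real s) / of_real s)) \<longlongrightarrow> Im D) (at (0::real))"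
    by (rule tendsto_Im)
  moreover have "\<forall>\<^sub>F s in at (0::real). Im (f (of_real s) / of_real s) = 0"
    unfolding eventually_at using \<epsilon> re by (intro exI[of _ \<epsilon>]) (auto simp: dist_real_def)
  ultimately have "((\<lambda>s. 0) \<longlongrightarrow> Im D) (at (0::real))"
    by (rule Lim_transform_eventually)
  thus ?thesis
    by (simp add: tendsto_const_iff)
qed

theorem theorem9:
  fixes l :: real
    and haar :: "nat \<Rightarrow> complex mat measure"
    and P :: "nat \<Rightarrow> 'w measure"
    and A :: "nat \<Rightarrow> 'w \<Rightarrow> complex mat"
    and \<Psi> :: "complex \<Rightarrow> complex"
    and S :: "complex set"
  assumes "l > 1"
    and "\<And>N. N \<ge> 1 \<Longrightarrow> haar_unitary N (haar N)"
    and "\<And>N. N \<ge> 1 \<Longrightarrow> random_hermitian N (P N) (A N)"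
    and "open S" and "0 \<in> S" and "\<Psi> holomorphic_on S"
    and "\<And>r. r \<ge> 1 \<Longrightarrow> \<exists>\<epsilon>>0. \<exists>L :: nat \<Rightarrow> (nat \<Rightarrow> complex) \<Rightarrow> complex.
           (\<forall>\<^sub>F N in sequentially.
              (\<forall>x\<in>polydisc0 r \<epsilon>. integrable (P N) (\<lambda>\<omega>. HC (haar N) N x (eigval (A N \<omega>)))) \<and>
              log_branch (polydisc0 r \<epsilon>)
                (\<lambda>x. \<integral>\<omega>. HC (haar N) N x (eigval (A N \<omega>)) \<partial>P N) (L N)) \<and>
           uniform_limit (polydisc0 r \<epsilon>)
             (\<lambda>N x. L N x / complex_of_real (real N powr l)) (\<lambda>x. \<Sum>i<r. \<Psi> (x i)) sequentially"
  shows "\<forall>k\<ge>1. converges_in_prob P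
           (\<lambda>N \<omega>. complex_of_real
              (1 / real N * (\<Sum>i<N. (real N powr (- l) * eigval (A N \<omega>) i) ^ k)))
           ((deriv \<Psi> 0) ^ k)"
proof (intro allI impI)
  fix k :: nat
  note haar = assms(2) and herm = assms(3)
  define F where "F N x = (\<integral>\<omega>. HC (haar N) N x (eigval (A N \<omega>)) \<partial>P N)" for N x
  obtain \<epsilon> L where \<epsilon>: "\<epsilon> > 0"
    and ev: "\<forall>\<^sub>F N in sequentially.
       (\<forall>x\<in>polydisc0 1 \<epsilon>. integrable (P N) (\<lambda>\<omega>. HC (haar N) N x (eigval (A N \<omega>)))) \<and>
       log_branch (polydisc0 1 \<epsilon>) (F N) (L N)"
    and unif: "uniform_limit (polydisc0 1 \<epsilon>)
       (\<lambda>N x. L N x / complex_of_real (real N powr l)) (\<lambda>x. \<Sum>i<1. \<Psi> (x i)) sequentially"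
    using assms(7)[of 1] unfolding F_def by auto
  have lim: "(\<lambda>N. L N (first_point z) / complex_of_real (real N powr l)) \<longlonglongrightarrow> \<Psi> z"
    if "cmod z < \<epsilon>" for z
    using tendsto_uniform_limitI[OF unif first_point_in_polydisc0[OF that]] by simp
  have real: "\<forall>\<^sub>F N in sequentially. \<forall>s::real. \<bar>s\<bar> < \<epsilon> \<longrightarrow> Im (L N (first_point (of_real s))) = 0"
    using ev eventually_ge_at_top[of 1]
  proof eventually_elim
    case (elim N)
    have "Im (F N (first_point (of_real s))) = 0" for s :: real
      unfolding F_def HC_first_point[OF haar[OF elim(2)] elim(2)] by simp
    thus ?case
      using elim(1) log_branch_real_on_reals by blast
  qed
  \<comment> \<open>Hence \<open>\<Psi>\<close> is real on the real axis, and so is its derivative at the origin; only a real number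
     can be the limit of averages of eigenvalues.\<close>
  have \<Psi>_real: "Im (\<Psi> (of_real s)) = 0" if "\<bar>s\<bar> < \<epsilon>" for s :: real
  proof -
    have "(\<lambda>N. Im (L N (first_point (of_real s)) / complex_of_real (real N powr l))) \<longlonglongrightarrow> Im (\<Psi> (of_real s))"
      using lim[of "of_real s"] that by (intro tendsto_Im) simp
    moreover have "\<forall>\<^sub>F N in sequentially. Im (L N (first_point (of_real s)) / complex_of_real (real N powr l)) = 0"
      using real by eventually_elim (use that in simp)
    ultimately have "(\<lambda>N. 0) \<longlonglongrightarrow> Im (\<Psi> (of_real s))"
      by (rule Lim_transform_eventually)
    thus ?thesis by (simp add: LIMSEQ_const_iff)
  qed
  have \<Psi>0: "\<Psi> 0 = 0"
  proof -
    have "first_point 0 = (\<lambda>_. 0)" by auto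
    moreover have "\<forall>\<^sub>F N in sequentially. L N (\<lambda>_. 0) = 0"
      using ev by eventually_elim (simp add: log_branch_def)
    ultimately have "\<forall>\<^sub>F N in sequentially. L N (first_point 0) / complex_of_real (real N powr l) = 0"
      by (auto elim: eventually_mono)
    from Lim_transform_eventually[OF lim this] \<epsilon> show ?thesis
      by (simp add: LIMSEQ_const_iff)
  qed
  have D: "(\<Psi> has_field_derivative deriv \<Psi> 0) (at 0)"
    by (rule holomorphic_derivI[OF assms(6,4,5)])
  define c where "c = Re (deriv \<Psi> 0)"
  have c: "deriv \<Psi> 0 = of_real c"
    using deriv_real_of_real_on_reals[OF D \<Psi>0 \<epsilon> \<Psi>_real] by (simp add: c_def complex_eq_iff)
  define Y where "Y N \<omega> = 1 / real N * (\<Sum>i<N. (real N powr (- l) * eigval (A N \<omega>) i) ^ k)" for N \<omega>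
  have "converges_in_prob P (\<lambda>N \<omega>. complex_of_real (Y N \<omega>)) (deriv \<Psi> 0 ^ k)"
    unfolding converges_in_prob_def
  proof (intro conjI allI impI)
    fix N :: nat assume N: "N \<ge> 1"
    have "(\<lambda>\<omega>. of_real (1 / real N * (real N powr (- l)) ^ k) * mat_trace (A N \<omega> ^\<^sub>m k)) \<in> borel_measurable (P N)"
      using herm[OF N] by (intro borel_measurable_times borel_measurable_const borel_measurable_trace_pow[of _ _ N])
        (simp add: random_hermitian_def)
    thus "(\<lambda>\<omega>. complex_of_real (Y N \<omega>)) \<in> borel_measurable (P N)"
    proof (rule measurable_cong[THEN iffD1, rotated])
      fix \<omega> assume "\<omega> \<in> space (P N)"
      hence "A N \<omega> \<in> hermitian_mats N"
        using herm[OF N] by (simp add: random_hermitian_def)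
      from sum_eigval_power_eq_trace[OF this, of k, symmetric]
      show "of_real (1 / real N * (real N powr (- l)) ^ k) * mat_trace (A N \<omega> ^\<^sub>m k) = complex_of_real (Y N \<omega>)"
        by (simp add: Y_def power_mult_distrib sum_distrib_left mult.assoc)
    qed
  next
    fix e :: real assume e: "e > 0"
    have "isCont (\<lambda>y::real. y ^ k) c" by simp
    then obtain \<delta> where \<delta>: "\<delta> > 0" "\<And>y. \<bar>y - c\<bar> < \<delta> \<Longrightarrow> \<bar>y ^ k - c ^ k\<bar> < e"
      using e unfolding continuous_at_eps_delta dist_real_def by blast
    have "\<delta> / 8 > 0" using \<delta> by simp
    with D obtain \<rho> where \<rho>: "\<rho> > 0" "\<And>z. cmod z < \<rho> \<Longrightarrow> cmod (\<Psi> z - of_real c * z) \<le> \<delta> / 8 * cmod z"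
      unfolding has_field_derivative_def has_derivative_at_alt by (fastforce simp: \<Psi>0 c)
    \<comment> \<open>Small enough that on \<open>\<bar>s\<bar> = t\<close> the linear term \<open>c * s\<close> of \<open>\<Psi>\<close> dominates, up to \<open>t * \<delta> / 8\<close>.\<close>
    define t where "t = min \<epsilon> \<rho> / 2"
    have t: "t > 0" "t < \<epsilon>" "t < \<rho>"
      using \<epsilon> \<rho>(1) by (auto simp: t_def min_def)
    \<comment> \<open>The error \<open>t * \<delta> / 4\<close> collects the remainder of \<open>\<Psi>\<close> and the distance to the limit, half each.
       It must stay below the gain \<open>t * \<delta> / 2\<close> of the exponential Markov inequality.\<close>
    have upper: "\<forall>\<^sub>F N in sequentially.
        Re (F N (first_point (of_real s))) \<le> exp (real N powr l * (s * c + t * \<delta> / 4))"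
      if s: "\<bar>s\<bar> = t" for s
    proof -
      have s\<epsilon>: "cmod (of_real s) < \<epsilon>" and s\<rho>: "cmod (of_real s) < \<rho>"
        using s t by auto
      have "t * \<delta> / 8 > 0" using t \<delta> by simp
      from tendstoD[OF lim[OF s\<epsilon>] this] ev eventually_ge_at_top[of 1]
      show ?thesis
      proof eventually_elim
        case (elim N)
        let ?x = "first_point (complex_of_real s)"
        have Nl: "real N powr l > 0" using elim(3) by simp
        have FL: "F N ?x = exp (L N ?x)"
          using elim(2) first_point_in_polydisc0[OF s\<epsilon>] by (simp add: log_branch_def)
        have "Re (L N ?x) / real N powr l = Re (L N ?x / of_real (real N powr l))"
          by simp
        also have "\<dots> = s * c + Re (L N ?x / of_real (real N powr l) - \<Psi> (of_real s)) + Re (\<Psi> (of_real s) - of_real c * of_real s)"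
          by simp
        also have "\<dots> \<le> s * c + t * \<delta> / 8 + \<delta> / 8 * t"
        proof -
          have "Re (L N ?x / of_real (real N powr l) - \<Psi> (of_real s)) \<le> t * \<delta> / 8"
            using complex_Re_le_cmod elim(1) unfolding dist_norm by (meson less_imp_le order_trans)
          moreover have "Re (\<Psi> (of_real s) - of_real c * of_real s) \<le> \<delta> / 8 * t"
            using complex_Re_le_cmod[of "\<Psi> (of_real s) - of_real c * of_real s"] \<rho>(2)[OF s\<rho>] s by simp
          ultimately show ?thesis by linarith
        qed
        also have "\<dots> = s * c + t * \<delta> / 4"
          by simp
        finally have "Re (L N ?x) \<le> real N powr l * (s * c + t * \<delta> / 4)"
          using Nl by (simp add: divide_le_eq mult.commute)
        hence "cmod (F N ?x) \<le> exp (real N powr l * (s * c + t * \<delta> / 4))"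
          by (simp add: FL)
        thus ?case
          using complex_Re_le_cmod order_trans by blast
      qed
    qed
    let ?B = "\<lambda>N. {\<omega> \<in> space (P N). dist (complex_of_real (Y N \<omega>)) (deriv \<Psi> 0 ^ k) > e}"
    let ?M = "\<lambda>N. real (6 * N + 1) ^ (2 * N)"
    have t_abs: "\<bar>t\<bar> = t" "\<bar>- t\<bar> = t"
      using t by simp_all
    have bound: "\<forall>\<^sub>F N in sequentially. measure (P N) (?B N) \<le> 2 * (?M N * exp (- (t * \<delta> / 4) * real N powr l))"
      using upper[OF t_abs(1)] upper[OF t_abs(2)] ev eventually_ge_at_top[of 1]
    proof eventually_elim
      case (elim N)
      let ?n = "real N powr l"
      have n: "?n > 0" using elim(4) by simp
      have dev: "\<exists>i<N. \<delta> * ?n \<le> \<bar>eigval (A N \<omega>) i - c * ?n\<bar>" if \<omega>: "\<omega> \<in> ?B N" for \<omega>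
      proof (rule ccontr)
        assume neg: "\<not> ?thesis"
        let ?y = "\<lambda>i. real N powr (- l) * eigval (A N \<omega>) i"
        have y: "\<bar>?y i ^ k - c ^ k\<bar> < e" if "i < N" for i
        proof (rule \<delta>(2))
          have "?y i - c = (eigval (A N \<omega>) i - c * ?n) / ?n"
            using n by (simp add: powr_minus field_simps)
          moreover have "\<bar>eigval (A N \<omega>) i - c * ?n\<bar> < \<delta> * ?n"
            using neg that by (meson not_le)
          ultimately show "\<bar>?y i - c\<bar> < \<delta>"
            using n by (simp add: abs_divide divide_less_eq)
        qed
        have "Y N \<omega> - c ^ k = (\<Sum>i<N. ?y i ^ k - c ^ k) / real N"
          using elim(4) by (simp add: Y_def sum_subtractf diff_divide_distrib)
        hence "\<bar>Y N \<omega> - c ^ k\<bar> \<le> (\<Sum>i<N. e) / real N"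
          using y by (simp only: abs_divide abs_of_nat)
            (intro divide_right_mono order_trans[OF sum_abs sum_mono], auto simp: less_imp_le)
        also have "\<dots> = e"
          using elim(4) by simp
        finally have "dist (complex_of_real (Y N \<omega>)) (deriv \<Psi> 0 ^ k) \<le> e"
          unfolding c dist_norm of_real_power[symmetric] of_real_diff[symmetric] norm_of_real .
        thus False
          using \<omega> by simp
      qed
      have "measure (P N) (?B N) \<le> ?M N * exp (- t * (\<delta> * ?n) / 2)
          * (exp (- t * (c * ?n)) * Re (F N (first_point (of_real t)))
            + exp (t * (c * ?n)) * Re (F N (first_point (of_real (- t)))))"
        unfolding F_def
      proof (rule deviation_probability_bound)
        show "haar_unitary N (haar N)" "N \<ge> 1" using haar elim(4) by auto
        show "prob_space (P N)" using herm[OF elim(4)] by (simp add: random_hermitian_def)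
        show "t \<ge> 0" using t by simp
        show "integrable (P N) (\<lambda>\<omega>. HC (haar N) N (first_point (of_real t)) (eigval (A N \<omega>)))"
          "integrable (P N) (\<lambda>\<omega>. HC (haar N) N (first_point (of_real (- t))) (eigval (A N \<omega>)))"
          using elim(3) t by (auto simp del: One_nat_def intro!: first_point_in_polydisc0)
        show "\<omega> \<in> space (P N) \<and> (\<exists>i<N. \<delta> * ?n \<le> \<bar>eigval (A N \<omega>) i - c * ?n\<bar>)" if "\<omega> \<in> ?B N" for \<omega>
          using dev[OF that] that by blast
      qed
      also have "\<dots> \<le> ?M N * exp (- t * (\<delta> * ?n) / 2)
          * (exp (- t * (c * ?n)) * exp (?n * (t * c + t * \<delta> / 4))
            + exp (t * (c * ?n)) * exp (?n * (- t * c + t * \<delta> / 4)))"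
        using elim(1,2) t by (intro mult_left_mono add_mono) auto
      also have "\<dots> = 2 * (?M N * exp (- (t * \<delta> / 4) * ?n))"
      proof -
        have "exp (- t * (c * ?n)) * exp (?n * (t * c + t * \<delta> / 4)) = exp (?n * t * \<delta> / 4)"
          "exp (t * (c * ?n)) * exp (?n * (- t * c + t * \<delta> / 4)) = exp (?n * t * \<delta> / 4)"
          by (simp_all add: mult_exp_exp algebra_simps)
        moreover have "exp (- t * (\<delta> * ?n) / 2) * exp (?n * t * \<delta> / 4) = exp (- (t * \<delta> / 4) * ?n)"
          by (simp add: mult_exp_exp algebra_simps)
        ultimately show ?thesis
          by (simp only: mult.assoc distrib_left mult_2)
      qed
      finally show ?case .
    qed
    have "(\<lambda>N. 2 * (?M N * exp (- (t * \<delta> / 4) * real N powr l))) \<longlonglongrightarrow> 0"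
      using tendsto_mult_left[OF superexponential_decay[OF assms(1), of "t * \<delta> / 4"], of 2] t \<delta> by simp
    from tendsto_sandwich[OF _ bound tendsto_const this]
    show "(\<lambda>N. measure (P N) (?B N)) \<longlonglongrightarrow> 0"
      by simp
  qed
  thus "converges_in_prob P
           (\<lambda>N \<omega>. complex_of_real
              (1 / real N * (\<Sum>i<N. (real N powr (- l) * eigval (A N \<omega>) i) ^ k)))
           ((deriv \<Psi> 0) ^ k)"
    unfolding Y_def .
qed

end
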